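(* Let $\mathbb{F}$ be an algebraically closed field of characteristic zero, let $m,n,d,r$ be positive integers, let $\mathbf{x}=(x_1,\ldots,x_n)$, and let $L:\mathbb{F}[\mathbf{x}]\to \mathrm{Mat}_m(\mathbb{F})$ be an $\mathbb{F}$-linear map. Suppose that for every affine form $\ell(\mathbf{x})=a_0+\sum_{i=1}^n a_i x_i$ with $(a_0,a_1,\ldots,a_n)\in\mathbb{F}^{n+1}$ we have $\mathrm{rank}(L(\ell^d))\le r$. Then for every polynomial $f(\mathbf{x})\in\mathbb{F}[\mathbf{x}]$ of degree at most $d$, $$\mathrm{rank}(L(f))\le r(d+1)\binom{n+\lfloor d/2\rfloor}{n}.$$
   Context: $\mathrm{Mat}_m(\mathbb{F})$ denotes the space of $m\times m$ matrices over $\mathbb{F}$, and $\mathrm{rank}$ is the usual matrix rank over $\mathbb{F}$. *)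

theory Defs
  imports
    "HOL-Analysis.Analysis"
    "HOL-Computational_Algebra.Computational_Algebra"
    "HOL-Library.Poly_Mapping"
begin

text \<open>
  The polynomial ring in the variables \<open>x\<^sub>i\<close>, \<open>i :: 'n\<close>, with \<open>'n\<close> a finite type: exponent vectors
  are mapped to coefficients, and multiplication is the convolution product of
  \<^theory>\<open>HOL-Library.Poly_Mapping\<close>.
\<close>

type_synonym ('n, 'a) mpoly = "('n \<Rightarrow>\<^sub>0 nat) \<Rightarrow>\<^sub>0 'a"

definition mconst :: "'a::zero \<Rightarrow> ('n, 'a) mpoly"
  where "mconst c = Poly_Mapping.single 0 c"

definition mvar :: "'n \<Rightarrow> ('n, 'a::zero_neq_one) mpoly"
  where "mvar i = Poly_Mapping.single (Poly_Mapping.single i 1) 1"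

definition mscale :: "'a::semiring_0 \<Rightarrow> ('n, 'a) mpoly \<Rightarrow> ('n, 'a) mpoly"
  where "mscale c p = Poly_Mapping.map (\<lambda>b. c * b) p"

text \<open>The zero polynomial gets total degree \<open>0\<close>.\<close>

definition total_degree :: "('n::finite, 'a::zero) mpoly \<Rightarrow> nat"
  where "total_degree p =
    Max (insert 0 ((\<lambda>e. \<Sum>i\<in>UNIV. Poly_Mapping.lookup e i) ` Poly_Mapping.keys p))"

definition affine_form :: "'a::comm_semiring_1 \<Rightarrow> ('n::finite \<Rightarrow> 'a) \<Rightarrow> ('n, 'a) mpoly"
  where "affine_form a\<^sub>0 a = mconst a\<^sub>0 + (\<Sum>i\<in>UNIV. mconst (a i) * mvar i)"

definition matscale :: "'a::times \<Rightarrow> 'a^'n^'m \<Rightarrow> 'a^'n^'m"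
  where "matscale c A = map_matrix (\<lambda>b. c * b) A"

lemma lookup_mscale: "Poly_Mapping.lookup (mscale c p) e = c * Poly_Mapping.lookup p e"
  by (auto simp: mscale_def Poly_Mapping.map.rep_eq when_def)

lemma mscale_eq_mult: "mscale c p = mconst c * p"
  unfolding mscale_def mconst_def by (rule mult_map_scale_conv_mult)

text \<open>
  The two vector space structures, so that \<^const>\<open>Vector_Spaces.linear\<close> for these scalings
  amounts to additivity and homogeneity.
\<close>

lemma vector_space_mscale: "vector_space (mscale :: 'a::field \<Rightarrow> ('n, 'a) mpoly \<Rightarrow> _)"
  by unfold_locales
    (auto intro!: poly_mapping_eqI simp: lookup_mscale lookup_add algebra_simps)

lemma vector_space_matscale: "vector_space (matscale :: 'a::field \<Rightarrow> 'a^'n^'m \<Rightarrow> _)"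
  by unfold_locales (auto simp: matscale_def vec_eq_iff algebra_simps)

lemma linear_mscale_matscale_iff:
  fixes L :: "('n, 'a::field) mpoly \<Rightarrow> 'a^'k^'m"
  shows "Vector_Spaces.linear mscale matscale L \<longleftrightarrow>
    (\<forall>p q. L (p + q) = L p + L q) \<and> (\<forall>c p. L (mscale c p) = matscale c (L p))"
  using vector_space_mscale vector_space_matscale
  by (auto simp: Vector_Spaces.linear_iff)

lemma total_degree_le_iff:
  "total_degree p \<le> d \<longleftrightarrow>
    (\<forall>e\<in>Poly_Mapping.keys p. (\<Sum>i\<in>UNIV. Poly_Mapping.lookup e i) \<le> d)"
  by (auto simp: total_degree_def)

end

theory Submission
  imports Defs
begin

text \<open>
  Write \<open>M t = L (t ^ d)\<close> for an affine form \<open>t\<close>. Choose \<open>P\<close> so that \<open>M P\<close> has the largest rank \<open>s \<le> r\<close> among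
  all \<open>M t\<close>. Near \<open>P\<close> the rank is constant, so the expansion of \<open>M (P + z t)\<close> in \<open>z\<close> factors as a
  product of power series through a fixed matrix \<open>G\<close> of rank \<open>s\<close>, and the coefficients of \<open>z ^ k\<close> in the
  factors are polynomials of degree at most \<open>k\<close> in the coefficients of \<open>t\<close>. Comparing the
  coefficients of \<open>z ^ d\<close> yields \<open>M t = (\<Sum>j\<le>d. U\<^sub>j t ** G ** V\<^bsub>d-j\<^esub> t)\<close>. In each summand one factor has
  degree at most \<open>d div 2\<close>; expanding that factor into monomials shows that all \<open>M t\<close> with \<open>t\<close> of constant
  term 1 lie in one linear space of matrices obeying the rank bound. As the powers \<open>t ^ d\<close> of such forms
  span the polynomials of degree at most \<open>d\<close>, the bound extends to every \<open>L f\<close>.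
\<close>

section \<open>Rank over a field\<close>

lemma matrix_add_rdistrib: "(A + B) ** C = A ** C + B ** C"
  by (vector matrix_matrix_mult_def sum.distrib[symmetric] field_simps)

lemma matrix_sub_rdistrib:
  fixes A B :: "'a::ring_1^'n^'m"
  shows "(A - B) ** C = A ** C - B ** C"
  by (vector matrix_matrix_mult_def sum_subtractf[symmetric] field_simps)

lemma matrix_sum_ldistrib: "A ** (\<Sum>i\<in>I. B i) = (\<Sum>i\<in>I. A ** B i)"
  by (induction I rule: infinite_finite_induct) (auto simp: matrix_add_ldistrib)

lemma matrix_sum_rdistrib: "(\<Sum>i\<in>I. A i) ** B = (\<Sum>i\<in>I. A i ** B)"
  by (induction I rule: infinite_finite_induct) (auto simp: matrix_add_rdistrib)

section \<open>Row spaces and elementary rank inequalities\<close>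

lemma linear_vector_matrix_mult:
  fixes A :: "'a::field^'n^'m"
  shows "Vector_Spaces.linear (*s) (*s) (\<lambda>x. x v* A)"
  using matrix_vector_mul_linear_gen[of "transpose A"]
  by (simp del: transpose_matrix_vector add: transpose_matrix_vector[symmetric])

lemma range_vector_matrix_mult:
  fixes A :: "'a::field^'n^'m"
  shows "range (\<lambda>x. x v* A) = vec.span (rows A)"
proof
  have "transpose A *v x \<in> vec.span (columns (transpose A))" for x
    by (rule matrix_vector_mult_in_columnspace_gen)
  then show "range (\<lambda>x. x v* A) \<subseteq> vec.span (rows A)"
    by (auto simp: columns_transpose)
next
  have "axis i 1 v* A = row i A" for i
    by (auto simp: vec_eq_iff vector_matrix_mult_def row_def axis_def
        if_distrib[of "\<lambda>c. c * _"] cong: if_cong)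
  then have "rows A \<subseteq> range (\<lambda>x. x v* A)"
    by (auto simp: rows_def) (metis rangeI)
  moreover have "vec.subspace (range (\<lambda>x. x v* A))"
    by (rule vec.linear_subspace_image[OF linear_vector_matrix_mult vec.subspace_UNIV])
  ultimately show "vec.span (rows A) \<subseteq> range (\<lambda>x. x v* A)"
    by (rule vec.span_minimal)
qed

text \<open>Describing the rank by an image turns matrix products into compositions of linear
  maps.\<close>

lemma rank_eq_dim_range:
  fixes A :: "'a::field^'n^'m"
  shows "rank A = vec.dim (range (\<lambda>x. x v* A))"
  by (simp add: range_vector_matrix_mult row_rank_def_gen vec.dim_span)

lemma rank_matrix_mult_le_right:
  fixes A :: "'a::field^'n^'m" and B :: "'a^'k^'n"
  shows "rank (A ** B) \<le> rank B"
  unfolding rank_eq_dim_range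
  by (rule vec.dim_subset) (auto simp: vector_matrix_mul_assoc[symmetric])

lemma rank_matrix_mult_le_left:
  fixes A :: "'a::field^'n^'m" and B :: "'a^'k^'n"
  shows "rank (A ** B) \<le> rank A"
proof -
  have "range (\<lambda>x. x v* (A ** B)) = (\<lambda>y. y v* B) ` range (\<lambda>x. x v* A)"
    by (simp add: image_image vector_matrix_mul_assoc)
  then show ?thesis
    unfolding rank_eq_dim_range by (metis vec.dim_image_le linear_vector_matrix_mult)
qed

text \<open>Bases of the two row spaces together span the rows of the sum.\<close>

lemma rank_add_le:
  fixes A B :: "'a::field^'n^'m"
  shows "rank (A + B) \<le> rank A + rank B"
proof -
  obtain S where S: "vec.independent S" "rows A \<subseteq> vec.span S" "card S = rank A"
    unfolding row_rank_def_gen by (metis vec.basis_exists)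
  obtain T where T: "vec.independent T" "rows B \<subseteq> vec.span T" "card T = rank B"
    unfolding row_rank_def_gen by (metis vec.basis_exists)
  have "row i A + row i B \<in> vec.span (S \<union> T)" for i
  proof (rule vec.span_add)
    show "row i A \<in> vec.span (S \<union> T)"
      using S(2) vec.span_mono[of S "S \<union> T"] by (auto simp: rows_def)
    show "row i B \<in> vec.span (S \<union> T)"
      using T(2) vec.span_mono[of T "S \<union> T"] by (auto simp: rows_def)
  qed
  moreover have "row i (A + B) = row i A + row i B" for i
    by (simp add: row_def vec_eq_iff)
  ultimately have "rows (A + B) \<subseteq> vec.span (S \<union> T)"
    by (auto simp: rows_def)
  then have "rank (A + B) \<le> card (S \<union> T)"
    unfolding row_rank_def_gen
    by (rule vec.dim_le_card) (use S(1) T(1) vec.finiteI_independent in auto)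
  also have "\<dots> \<le> rank A + rank B"
    using card_Un_le[of S T] S(3) T(3) by simp
  finally show ?thesis .
qed

lemma rank_zero: "rank (0 :: 'a::field^'n^'m) = 0"
  using rank_matrix_mult_le_left[of "0 :: 'a^'n^'m" "0 :: 'a^'n^'n"]
  by (simp add: rank_eq_dim_range image_constant_conv vec.dim_insert)

lemma rank_sum_le:
  fixes A :: "'i \<Rightarrow> 'a::field^'n^'m"
  assumes "\<And>i. i \<in> I \<Longrightarrow> rank (A i) \<le> c i"
  shows "rank (\<Sum>i\<in>I. A i) \<le> (\<Sum>i\<in>I. c i)"
  using assms
proof (induction I rule: infinite_finite_induct)
  case (insert i I)
  then show ?case
    using rank_add_le[of "A i" "sum A I"] by fastforce
qed (auto simp: rank_zero)

section \<open>Generalised inverses and dimension-preserving maps\<close>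

lemma generalized_inverse_exists:
  fixes M :: "'a::field^'n^'m"
  shows "\<exists>G. M ** G ** M = M \<and> rank G \<le> rank M"
proof -
  obtain g where g: "Vector_Spaces.linear (*s) (*s) g"
    "\<forall>v\<in>(*v) M ` UNIV. M *v g v = v"
    using vec.linear_exists_right_inverse_on[OF matrix_vector_mul_linear_gen[of M] vec.subspace_UNIV]
    by metis
  define H where "H = matrix g"
  have H: "H *v v = g v" for v
    unfolding H_def using g(1) by (rule matrix_works)
  have "(M ** H ** M) *v x = M *v x" for x
    using g(2) by (simp add: matrix_vector_mul_assoc[symmetric] H)
  then have MHM: "M ** H ** M = M"
    by (simp add: matrix_eq)
  \<comment> \<open>\<open>H\<close> inverts \<open>M\<close> on its range, but its rank may exceed
    that of \<open>M\<close>. Passing to \<open>H ** M ** H\<close> keeps the identity and caps the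
    rank.\<close>
  have "M ** (H ** M ** H) ** M = M"
    by (metis MHM matrix_mul_assoc)
  moreover have "rank (H ** M ** H) \<le> rank M"
    by (meson order_trans rank_matrix_mult_le_left rank_matrix_mult_le_right)
  ultimately show ?thesis
    by blast
qed

lemma linear_inj_on_of_dim_le:
  fixes f :: "'a::field^'n \<Rightarrow> 'a^'m"
  assumes f: "Vector_Spaces.linear (*s) (*s) f" and S: "vec.subspace S"
    and dim: "vec.dim S \<le> vec.dim (f ` S)"
  shows "inj_on f S"
proof -
  interpret f: Vector_Spaces.linear "(*s)" "(*s)" f by fact
  obtain B where B: "B \<subseteq> S" "vec.independent B" "S \<subseteq> vec.span B" "card B = vec.dim S"
    by (metis vec.basis_exists)
  have fin: "finite B"
    using B(2) by (rule vec.finiteI_independent)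
  have span: "vec.span B = S"
    using B(1,3) S by (metis vec.span_subspace)
  have "vec.dim (f ` S) \<le> card (f ` B)"
    by (rule vec.dim_le_card) (use fin span f.span_image[of B] in auto)
  then have card: "card (f ` B) = card B"
    using dim B(4) card_image_le[OF fin, of f] by linarith
  then have "inj_on f B"
    using fin by (simp add: eq_card_imp_inj_on)
  moreover have "vec.independent (f ` B)"
    by (rule vec.card_le_dim_spanning[of _ "f ` S"])
      (use B card dim fin span f.span_image[of B] in auto)
  ultimately show ?thesis
    using f.inj_on_span_independent_image span by metis
qed

text \<open>
  Since \<open>E ** M\<^sub>0 = M ** G ** M\<^sub>0\<close>, right multiplication by \<open>G ** M\<^sub>0\<close> does not lower the rank of \<open>M\<close>,
  so it is injective on the row space of \<open>M\<close>. It kills the rows of \<open>(mat 1 - M\<^sub>0 ** G) ** V\<close>, which lie there.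
\<close>

lemma range_of_solution:
  fixes M M\<^sub>0 G V :: "'a::field^'n^'n"
  defines "E \<equiv> mat 1 + (M - M\<^sub>0) ** G"
  assumes G: "M\<^sub>0 ** G ** M\<^sub>0 = M\<^sub>0" and rank: "rank M \<le> rank M\<^sub>0"
    and inv: "invertible E" and EV: "E ** V = M"
  shows "M\<^sub>0 ** G ** V = V"
proof -
  obtain F where F: "F ** E = mat 1"
    using inv by (auto simp: invertible_left_inverse)
  have V: "V = F ** M"
    by (metis EV F matrix_mul_assoc matrix_mul_lid)
  have "E ** M\<^sub>0 = M\<^sub>0 + M ** G ** M\<^sub>0 - M\<^sub>0 ** G ** M\<^sub>0"
    by (simp add: E_def matrix_add_rdistrib matrix_sub_rdistrib matrix_mul_lid)
  then have EM: "E ** M\<^sub>0 = M ** (G ** M\<^sub>0)"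
    by (simp add: G matrix_mul_assoc)
  have FMG: "F ** M ** (G ** M\<^sub>0) = M\<^sub>0"
    by (metis EM F matrix_mul_assoc matrix_mul_lid)
  define f where "f = (\<lambda>x. x v* (G ** M\<^sub>0))"
  define S where "S = range (\<lambda>x. x v* M)"
  have "inj_on f S"
    unfolding f_def
  proof (rule linear_inj_on_of_dim_le[OF linear_vector_matrix_mult])
    show "vec.subspace S"
      by (simp add: S_def range_vector_matrix_mult)
    have "(\<lambda>x. x v* (G ** M\<^sub>0)) ` S = range (\<lambda>x. x v* (M ** (G ** M\<^sub>0)))"
      by (simp add: S_def image_image vector_matrix_mul_assoc)
    then have "vec.dim ((\<lambda>x. x v* (G ** M\<^sub>0)) ` S) = rank (E ** M\<^sub>0)"
      by (simp add: EM rank_eq_dim_range)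
    \<comment> \<open>\<open>F\<close> recovers \<open>M\<^sub>0\<close> from
      \<open>E ** M\<^sub>0\<close>, so no rank is lost.\<close>
    also have "rank M\<^sub>0 \<le> rank (E ** M\<^sub>0)"
      by (metis F matrix_mul_assoc matrix_mul_lid rank_matrix_mult_le_right)
    finally show "vec.dim S \<le> vec.dim ((\<lambda>x. x v* (G ** M\<^sub>0)) ` S)"
      using rank by (simp add: S_def rank_eq_dim_range)
  qed
  have "y v* (M\<^sub>0 ** G ** V) = y v* V" for y
  proof (rule inj_onD[OF \<open>inj_on f S\<close>])
    have "M\<^sub>0 ** G ** V ** (G ** M\<^sub>0) = V ** (G ** M\<^sub>0)"
      by (metis FMG G V matrix_mul_assoc)
    then show "f (y v* (M\<^sub>0 ** G ** V)) = f (y v* V)"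
      by (simp add: f_def vector_matrix_mul_assoc)
    have "x v* (F ** M) \<in> S" for x
      by (simp add: S_def vector_matrix_mul_assoc[symmetric])
    then show "y v* (M\<^sub>0 ** G ** V) \<in> S" "y v* V \<in> S"
      unfolding V by (metis vector_matrix_mul_assoc)+
  qed
  then show ?thesis
    by (metis matrix_eq matrix_transpose_mul transpose_matrix_vector transpose_transpose)
qed

section \<open>Factorisation of a matrix pencil of locally constant rank\<close>

lemma poly_det: "poly (det A) z = det (\<chi> i j. poly (A $ i $ j) z)"
  by (simp add: det_def poly_sum poly_prod)

text \<open>
  The coefficients of the power series \<open>V\<close> with \<open>(mat 1 + (M - N 0) ** G) ** V = M\<close>, where
  \<open>M = (\<Sum>k. N k * z ^ k)\<close>.
\<close>

fun solution_coeff :: "(nat \<Rightarrow> 'a::field^'n^'n) \<Rightarrow> 'a^'n^'n \<Rightarrow> nat \<Rightarrow> 'a^'n^'n" where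
  "solution_coeff N G k = N k - (\<Sum>j<k. N (k - j) ** G ** solution_coeff N G j)"

declare solution_coeff.simps [simp del]

text \<open>The product \<open>p * q\<close> vanishes at every point. Characteristic zero makes the
  ring infinite, so the product is the zero polynomial, and a domain has no zero divisors.\<close>

lemma poly_eq_0_of_cofinite:
  fixes p q :: "'a::{idom, ring_char_0} poly"
  assumes "q \<noteq> 0" and "\<And>z. poly q z \<noteq> 0 \<Longrightarrow> poly p z = 0"
  shows "p = 0"
proof -
  have "poly (p * q) z = 0" for z
    using assms(2)[of z] by auto
  then show ?thesis
    using assms(1) by (metis mult_eq_0_iff poly_all_0_iff_0)
qed

text \<open>
  By \<open>range_of_solution\<close> the claim holds for the values of the solution at generic \<open>z\<close>. Cramer's rule
  writes these as polynomials divided by a determinant \<open>\<delta>\<close> with constant term 1, hence invertible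
  as a power series, which carries the claim over to the coefficients.
\<close>

lemma range_of_solution_coeff:
  fixes N :: "nat \<Rightarrow> 'a::field_char_0^'n^'n"
  assumes G: "N 0 ** G ** N 0 = N 0" and deg: "\<And>k. d < k \<Longrightarrow> N k = 0"
    and rank: "\<And>z. rank (\<chi> a b. \<Sum>k\<le>d. N k $ a $ b * z ^ k) \<le> rank (N 0)"
  shows "N 0 ** G ** solution_coeff N G k = solution_coeff N G k"
proof -
  \<comment> \<open>\<open>p\<close> and \<open>e\<close> hold the entries of \<open>M\<close> and
    \<open>E\<close> as polynomials in \<open>z\<close>. \<open>D a b\<close> is a Cramer numerator:
    column \<open>a\<close> of \<open>e\<close> is replaced by column \<open>b\<close> of
    \<open>p\<close>.\<close>
  define p where "p a b = (\<Sum>k\<le>d. monom (N k $ a $ b) k)" for a b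
  define e where "e a b = (if a = b then 1 else 0)
      + (\<Sum>c\<in>UNIV. (p a c - [:N 0 $ a $ c:]) * [:G $ c $ b:])" for a b
  define \<delta> where "\<delta> = det (\<chi> a b. e a b)"
  define D where "D a b = det (\<chi> i j. if j = a then p i b else e i j)" for a b
  define E where "E z = mat 1 + ((\<chi> a b. \<Sum>k\<le>d. N k $ a $ b * z ^ k) - N 0) ** G" for z
  have coeff_p: "coeff (p a b) k = N k $ a $ b" for a b k
    using deg[of k] by (simp add: p_def coeff_sum not_le)
  have poly_p: "poly (p a b) z = (\<Sum>k\<le>d. N k $ a $ b * z ^ k)" for a b z
    by (simp add: p_def poly_sum poly_monom)
  have poly_e: "poly (e a b) z = E z $ a $ b" for a b z
    by (simp add: e_def E_def poly_sum poly_p mat_def matrix_matrix_mult_def mult.commute)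
  have coeff_e: "coeff (e a b) k = (if k = 0 then mat 1 else N k ** G) $ a $ b" for a b k
    by (cases k) (simp_all add: e_def coeff_sum coeff_p mat_def matrix_matrix_mult_def mult.commute)
  have poly_\<delta>: "poly \<delta> z = det (E z)" for z
    by (simp add: \<delta>_def poly_det poly_e)
  have poly_D: "poly (D a b) z = det (\<chi> i j. if j = a then poly (p i b) z else E z $ i $ j)" for a b z
    unfolding D_def poly_det
    by (rule arg_cong[where f = det]) (simp add: vec_eq_iff poly_e)
  have "E 0 = mat 1"
  proof -
    have "(\<Sum>k\<le>d. N k $ a $ b * 0 ^ k) = N 0 $ a $ b" for a b
      using poly_p[of a b 0] by (simp add: poly_0_coeff_0 coeff_p)
    then have "(\<chi> a b. \<Sum>k\<le>d. N k $ a $ b * 0 ^ k) = N 0"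
      by (simp add: vec_eq_iff)
    then show ?thesis
      by (simp add: E_def)
  qed
  then have \<delta>0: "poly \<delta> 0 = 1"
    by (simp add: poly_\<delta>)
  then have \<delta>: "\<delta> \<noteq> 0"
    by auto
  define X where "X z = (\<chi> a b. poly (D a b) z / poly \<delta> z)" for z
  have EX: "E z ** X z = (\<chi> a b. \<Sum>k\<le>d. N k $ a $ b * z ^ k)" if z: "poly \<delta> z \<noteq> 0" for z
  proof -
    have "E z *v (\<chi> a. poly (D a b) z / poly \<delta> z) = (\<chi> i. poly (p i b) z)" for b
      using z by (subst cramer) (auto simp: poly_\<delta> poly_D cong: if_cong)
    then show ?thesis
      by (simp add: X_def vec_eq_iff matrix_vector_mult_def matrix_matrix_mult_def poly_p)
  qed
  have NX: "N 0 ** G ** X z = X z" if z: "poly \<delta> z \<noteq> 0" for z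
  proof (rule range_of_solution[OF G rank[of z]])
    show "invertible (mat 1 + ((\<chi> a b. \<Sum>k\<le>d. N k $ a $ b * z ^ k) - N 0) ** G)"
      using z unfolding poly_\<delta> E_def by (simp add: invertible_det_nz)
    show "(mat 1 + ((\<chi> a b. \<Sum>k\<le>d. N k $ a $ b * z ^ k) - N 0) ** G) ** X z
        = (\<chi> a b. \<Sum>k\<le>d. N k $ a $ b * z ^ k)"
      using EX[OF z] by (simp add: E_def)
  qed
  \<comment> \<open>Both this identity and \<open>ND\<close> hold at every \<open>z\<close> with
    \<open>poly \<delta> z \<noteq> 0\<close>, after clearing the denominator, hence also between
    polynomials.\<close>
  have eD: "(\<Sum>c\<in>UNIV. e a c * D c b) = \<delta> * p a b" for a b
  proof -
    have "poly ((\<Sum>c\<in>UNIV. e a c * D c b) - \<delta> * p a b) z = 0" if z: "poly \<delta> z \<noteq> 0" for z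
    proof -
      have "(\<Sum>c\<in>UNIV. poly (e a c) z * (poly (D c b) z / poly \<delta> z)) = poly (p a b) z"
        using EX[OF z] by (simp add: X_def vec_eq_iff matrix_matrix_mult_def poly_p poly_e)
      then show ?thesis
        using z by (simp add: poly_sum sum_divide_distrib[symmetric] field_simps)
    qed
    then show ?thesis
      using poly_eq_0_of_cofinite[OF \<delta>] by fastforce
  qed
  have ND: "(\<Sum>c\<in>UNIV. [:(N 0 ** G) $ a $ c:] * D c b) = D a b" for a b
  proof -
    have "poly ((\<Sum>c\<in>UNIV. [:(N 0 ** G) $ a $ c:] * D c b) - D a b) z = 0"
      if z: "poly \<delta> z \<noteq> 0" for z
    proof -
      have "(\<Sum>c\<in>UNIV. (N 0 ** G) $ a $ c * (poly (D c b) z / poly \<delta> z)) = poly (D a b) z / poly \<delta> z"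
        using NX[OF z] by (simp add: X_def vec_eq_iff matrix_matrix_mult_def[of "N 0 ** G"])
      then show ?thesis
        using z by (simp add: poly_sum sum_divide_distrib[symmetric] field_simps)
    qed
    then show ?thesis
      using poly_eq_0_of_cofinite[OF \<delta>] by fastforce
  qed
  define \<iota> where "\<iota> = inverse (fps_of_poly \<delta>)"
  have \<iota>: "fps_of_poly \<delta> * \<iota> = 1"
    using \<delta>0 by (simp add: \<iota>_def inverse_mult_eq_1' poly_0_coeff_0)
  \<comment> \<open>\<open>W k\<close> is the coefficient of \<open>z ^ k\<close> in the power
    series of \<open>D\<close> divided by \<open>\<delta>\<close>.\<close>
  define W where "W k = (\<chi> a b. fps_nth (fps_of_poly (D a b) * \<iota>) k)" for k
  have NW: "N 0 ** G ** W k = W k" for k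
  proof -
    have "(\<Sum>c\<in>UNIV. (N 0 ** G) $ a $ c * fps_nth (fps_of_poly (D c b) * \<iota>) k)
        = fps_nth (fps_of_poly (D a b) * \<iota>) k" for a b
    proof -
      have "fps_of_poly (D a b) * \<iota>
          = (\<Sum>c\<in>UNIV. fps_const ((N 0 ** G) $ a $ c) * (fps_of_poly (D c b) * \<iota>))"
        by (subst ND[symmetric])
          (simp add: fps_of_poly_sum fps_of_poly_mult fps_of_poly_const sum_distrib_right mult.assoc
            del: mult_pCons_left)
      then show ?thesis
        by (simp add: fps_sum_nth)
    qed
    then show ?thesis
      by (simp add: W_def vec_eq_iff matrix_matrix_mult_def[of "N 0 ** G"])
  qed
  \<comment> \<open>Compare coefficients in \<open>eD\<close> divided by \<open>\<delta>\<close>.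
    The constant term of \<open>e\<close> is the identity matrix, which isolates \<open>W k\<close>;
    its later coefficients are the \<open>N (k - j) ** G\<close>. The result is the recursion of
    \<open>solution_coeff\<close>.\<close>
  have W: "W k = N k - (\<Sum>j<k. N (k - j) ** G ** W j)" for k
  proof -
    have "N k $ a $ b = W k $ a $ b + (\<Sum>j<k. N (k - j) ** G ** W j) $ a $ b" for a b
    proof -
      have "(\<Sum>c\<in>UNIV. fps_of_poly (e a c) * (fps_of_poly (D c b) * \<iota>)) = fps_of_poly (\<delta> * p a b) * \<iota>"
        unfolding eD[symmetric] by (simp add: fps_of_poly_sum fps_of_poly_mult sum_distrib_right mult.assoc)
      also have "\<dots> = fps_of_poly (p a b)"
        using \<iota> by (simp add: fps_of_poly_mult mult_ac)
      finally have "N k $ a $ b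
          = fps_nth (\<Sum>c\<in>UNIV. (fps_of_poly (D c b) * \<iota>) * fps_of_poly (e a c)) k"
        by (simp add: coeff_p mult.commute)
      also have "\<dots> = (\<Sum>c\<in>UNIV. \<Sum>j\<le>k. W j $ c $ b * coeff (e a c) (k - j))"
        by (simp only: fps_sum_nth fps_mult_nth[of "_ * \<iota>"] atLeast0AtMost) (simp add: W_def)
      also have "\<dots> = (\<Sum>c\<in>UNIV. \<Sum>j<k. W j $ c $ b * (N (k - j) ** G) $ a $ c)
          + (\<Sum>c\<in>UNIV. W k $ c $ b * mat 1 $ a $ c)"
        by (simp add: lessThan_Suc_atMost[symmetric] sum.distrib coeff_e)
      also have "(\<Sum>c\<in>UNIV. W k $ c $ b * mat 1 $ a $ c) = W k $ a $ b"
        by (simp add: mat_def if_distrib cong: if_cong)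
      also have "(\<Sum>c\<in>UNIV. \<Sum>j<k. W j $ c $ b * (N (k - j) ** G) $ a $ c)
          = (\<Sum>j<k. N (k - j) ** G ** W j) $ a $ b"
        by (subst sum.swap) (simp add: matrix_matrix_mult_def[of "_ ** G"] mult.commute)
      finally show ?thesis
        by simp
    qed
    then show ?thesis
      by (simp add: vec_eq_iff)
  qed
  have "solution_coeff N G k = W k" for k
  proof (induction k rule: less_induct)
    case (less k)
    then show ?case
      by (subst solution_coeff.simps, subst W) simp
  qed
  then show ?thesis
    using NW by simp
qed

text \<open>The recursion for \<open>solution_coeff\<close> solved for \<open>N k\<close> leaves one
  summand without a factor \<open>N 0 ** G\<close>. That summand is fixed by
  \<open>N 0 ** G\<close>, so it supplies the missing term.\<close>

lemma low_rank_decomposition: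
  fixes N :: "nat \<Rightarrow> 'a::field_char_0^'n^'n"
  assumes G: "N 0 ** G ** N 0 = N 0" and deg: "\<And>k. d < k \<Longrightarrow> N k = 0"
    and rank: "\<And>z. rank (\<chi> a b. \<Sum>k\<le>d. N k $ a $ b * z ^ k) \<le> rank (N 0)"
  shows "N k = (\<Sum>j\<le>k. N j ** G ** solution_coeff N G (k - j))"
proof -
  have "N k = solution_coeff N G k + (\<Sum>j<k. N (k - j) ** G ** solution_coeff N G j)"
    by (simp add: solution_coeff.simps[of N G k])
  also have "solution_coeff N G k = N (k - k) ** G ** solution_coeff N G k"
    using range_of_solution_coeff[OF assms] by simp
  also have "\<dots> + (\<Sum>j<k. N (k - j) ** G ** solution_coeff N G j)
      = (\<Sum>j\<le>k. N (k - j) ** G ** solution_coeff N G j)"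
    by (simp add: lessThan_Suc_atMost[symmetric])
  also have "\<dots> = (\<Sum>j\<le>k. N j ** G ** solution_coeff N G (k - j))"
    by (rule sum.reindex_bij_witness[of _ "\<lambda>j. k - j" "\<lambda>j. k - j"]) auto
  finally show ?thesis .
qed

section \<open>Polynomial functions and powers of affine forms\<close>

definition exponents :: "nat \<Rightarrow> ('n::finite \<Rightarrow> nat) set" where
  "exponents k = {\<alpha>. sum \<alpha> UNIV \<le> k}"

definition monomial_value :: "('n::finite \<Rightarrow> nat) \<Rightarrow> ('n \<Rightarrow> 'a::comm_semiring_1) \<Rightarrow> 'a" where
  "monomial_value \<alpha> t = (\<Prod>i\<in>UNIV. t i ^ \<alpha> i)"

text \<open>
  Stars and bars, with one more slot for the slack \<open>k - sum \<alpha> UNIV\<close>.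
\<close>

lemma finite_card_exponents:
  "finite (exponents k :: ('n::finite \<Rightarrow> nat) set) \<and>
    card (exponents k :: ('n \<Rightarrow> nat) set) \<le> (CARD('n) + k) choose CARD('n)"
proof -
  obtain xs :: "'n list" where xs: "set xs = UNIV" "distinct xs"
    using finite_distinct_list[of "UNIV :: 'n set"] by auto
  have len: "length xs = CARD('n)"
    using xs distinct_card by fastforce
  define F where "F \<alpha> = (k - sum \<alpha> UNIV) # map \<alpha> xs" for \<alpha> :: "'n \<Rightarrow> nat"
  define B where "B = {l :: nat list. size l = Suc CARD('n) \<and> sum_list l = k}"
  have inj: "inj_on F (exponents k)"
    using xs(1) by (auto simp: inj_on_def F_def fun_eq_iff)
  have FB: "F ` exponents k \<subseteq> B"
    using xs by (auto simp: F_def B_def exponents_def len sum_list_distinct_conv_sum_set)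
  have card_B: "card B = (k + CARD('n)) choose k"
    unfolding B_def card_length_sum_list by simp
  also have "\<dots> = (CARD('n) + k) choose CARD('n)"
    using binomial_symmetric[of k "k + CARD('n)"] by (simp add: add.commute)
  finally have card: "card B = (CARD('n) + k) choose CARD('n)" .
  \<comment> \<open>An infinite set would have cardinality 0, while this binomial coefficient is
    positive.\<close>
  then have fin: "finite B"
    by (intro card_ge_0_finite) simp
  show ?thesis
    using inj_on_finite[OF inj FB fin] card_inj_on_le[OF inj FB fin] card by simp
qed

text \<open>Polynomial functions of total degree at most \<open>k\<close>. Generating them by rules
  lets degree bounds be proved without tracking coefficients, which
  \<open>polyfun_le_expansion\<close> recovers at the end.\<close>

inductive polyfun_le :: "nat \<Rightarrow> (('n \<Rightarrow> 'a::comm_ring_1) \<Rightarrow> 'a) \<Rightarrow> bool" where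
  const: "polyfun_le k (\<lambda>_. c)"
| add: "polyfun_le k g \<Longrightarrow> polyfun_le k h \<Longrightarrow> polyfun_le k (\<lambda>t. g t + h t)"
| var: "polyfun_le k g \<Longrightarrow> polyfun_le (Suc k) (\<lambda>t. t i * g t)"

lemma polyfun_le_mono: "polyfun_le k g \<Longrightarrow> k \<le> l \<Longrightarrow> polyfun_le l g"
proof (induction arbitrary: l rule: polyfun_le.induct)
  case (var k g i)
  then show ?case
    by (cases l) (auto intro: polyfun_le.var)
qed (auto intro: polyfun_le.intros)

lemma polyfun_le_cmult: "polyfun_le k g \<Longrightarrow> polyfun_le k (\<lambda>t. c * g t)"
proof (induction rule: polyfun_le.induct)
  case (var k g i)
  then show ?case
    using polyfun_le.var[of k "\<lambda>t. c * g t" i] by (simp add: mult.left_commute)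
qed (auto intro: polyfun_le.intros simp: distrib_left)

lemma polyfun_le_mult: "polyfun_le k g \<Longrightarrow> polyfun_le l h \<Longrightarrow> polyfun_le (k + l) (\<lambda>t. g t * h t)"
proof (induction rule: polyfun_le.induct)
  case (const k c)
  then show ?case
    using polyfun_le_mono[OF polyfun_le_cmult, of l h] by simp
next
  case (var k g i)
  then show ?case
    using polyfun_le.var[of "k + l" "\<lambda>t. g t * h t" i] by (simp add: mult.assoc)
qed (auto intro: polyfun_le.intros simp: distrib_right)

lemma polyfun_le_sum: "(\<And>i. i \<in> I \<Longrightarrow> polyfun_le k (g i)) \<Longrightarrow> polyfun_le k (\<lambda>t. \<Sum>i\<in>I. g i t)"
  by (induction I rule: infinite_finite_induct) (auto intro: polyfun_le.intros)

lemma polyfun_le_diff: "polyfun_le k g \<Longrightarrow> polyfun_le k h \<Longrightarrow> polyfun_le k (\<lambda>t. g t - h t)"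
  using polyfun_le.add[OF _ polyfun_le_cmult[of k h "-1"], of g] by simp

lemma polyfun_le_expansion:
  fixes g :: "('n::finite \<Rightarrow> 'a::comm_ring_1) \<Rightarrow> 'a"
  assumes "polyfun_le k g"
  shows "\<exists>C. \<forall>t. g t = (\<Sum>\<alpha>\<in>exponents k. C \<alpha> * monomial_value \<alpha> t)"
  using assms
proof (induction rule: polyfun_le.induct)
  case (const k c)
  have *: "(\<Sum>\<alpha>\<in>exponents k. (if \<alpha> = (\<lambda>_. 0) then c else 0) * monomial_value \<alpha> t) = c"
    for t :: "'n \<Rightarrow> 'a"
  proof -
    have "(\<Sum>\<alpha>\<in>exponents k. (if \<alpha> = (\<lambda>_. 0) then c else 0) * monomial_value \<alpha> t)
        = (\<Sum>\<alpha>\<in>{\<lambda>_. 0}. (if \<alpha> = (\<lambda>_. 0) then c else 0) * monomial_value \<alpha> t)"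
      by (rule sum.mono_neutral_right) (use finite_card_exponents in \<open>auto simp: exponents_def\<close>)
    then show ?thesis
      by (simp add: monomial_value_def)
  qed
  show ?case
    by (intro exI allI) (rule *[symmetric])
next
  case (add k g h)
  then obtain C D where
    "\<forall>t. g t = (\<Sum>\<alpha>\<in>exponents k. C \<alpha> * monomial_value \<alpha> t)"
    "\<forall>t. h t = (\<Sum>\<alpha>\<in>exponents k. D \<alpha> * monomial_value \<alpha> t)"
    by blast
  then show ?case
    by (intro exI[of _ "\<lambda>\<alpha>. C \<alpha> + D \<alpha>"]) (simp add: distrib_right sum.distrib)
next
  case (var k g i)
  then obtain C where C: "\<forall>t. g t = (\<Sum>\<alpha>\<in>exponents k. C \<alpha> * monomial_value \<alpha> t)"
    by blast
  \<comment> \<open>Multiplication by \<open>t i\<close> shifts exponent vectors by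
    \<open>s\<close>. \<open>D\<close> carries the coefficients along and is 0 off the image of the
    shift.\<close>
  define s where "s \<alpha> = \<alpha>(i := Suc (\<alpha> i))" for \<alpha> :: "'n \<Rightarrow> nat"
  define D where "D \<alpha> = (if \<alpha> i = 0 then 0 else C (\<alpha>(i := \<alpha> i - 1)))" for \<alpha>
  have sum_upd: "sum (\<alpha>(i := x)) UNIV = x + sum \<alpha> (UNIV - {i})" for \<alpha> :: "'n \<Rightarrow> nat" and x
    by (subst sum.remove[of UNIV i]) auto
  have sum_rem: "sum \<alpha> UNIV = \<alpha> i + sum \<alpha> (UNIV - {i})" for \<alpha> :: "'n \<Rightarrow> nat"
    by (subst sum.remove[of UNIV i]) auto
  have mon: "monomial_value (s \<alpha>) t = t i * monomial_value \<alpha> t" for \<alpha> and t :: "'n \<Rightarrow> 'a"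
    unfolding monomial_value_def s_def
    by (subst (1 2) prod.remove[of UNIV i]) (auto simp: mult.assoc intro!: prod.cong)
  have inj: "inj_on s (exponents k)"
    by (rule inj_on_inverseI[of _ "\<lambda>\<alpha>. \<alpha>(i := \<alpha> i - 1)"]) (auto simp: s_def)
  have "t i * g t = (\<Sum>\<alpha>\<in>exponents (Suc k). D \<alpha> * monomial_value \<alpha> t)" for t
  proof -
    have "t i * g t = (\<Sum>\<alpha>\<in>exponents k. D (s \<alpha>) * monomial_value (s \<alpha>) t)"
      unfolding mon by (simp add: C sum_distrib_left D_def s_def mult_ac)
    also have "\<dots> = (\<Sum>\<alpha>\<in>s ` exponents k. D \<alpha> * monomial_value \<alpha> t)"
      using inj by (simp add: sum.reindex)
    also have "\<dots> = (\<Sum>\<alpha>\<in>exponents (Suc k). D \<alpha> * monomial_value \<alpha> t)"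
    proof (rule sum.mono_neutral_left)
      show "finite (exponents (Suc k) :: ('n \<Rightarrow> nat) set)"
        using finite_card_exponents by blast
      show "s ` exponents k \<subseteq> exponents (Suc k)"
        by (auto simp: exponents_def s_def sum_upd sum_rem)
      have "\<alpha> \<in> s ` exponents k" if "\<alpha> \<in> exponents (Suc k)" "\<alpha> i \<noteq> 0" for \<alpha>
      proof (rule image_eqI)
        show "\<alpha> = s (\<alpha>(i := \<alpha> i - 1))"
          using that(2) by (auto simp: s_def)
        show "\<alpha>(i := \<alpha> i - 1) \<in> exponents k"
          unfolding exponents_def mem_Collect_eq sum_upd
          using that sum_rem[of \<alpha>] by (simp add: exponents_def)
      qed
      then show "\<forall>\<alpha>\<in>exponents (Suc k) - s ` exponents k. D \<alpha> * monomial_value \<alpha> t = 0"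
        by (auto simp: D_def)
    qed
    finally show ?thesis .
  qed
  then show ?case
    by blast
qed

text \<open>
  Passing from \<open>p z\<close> to \<open>p (2 * z) - 2 ^ K * p z\<close> eliminates the top coefficient.
\<close>

lemma coeff_in_subspace:
  fixes w :: "nat \<Rightarrow> ('n, 'a::field_char_0) mpoly"
  assumes W: "module.subspace mscale W"
    and "\<And>z. (\<Sum>k\<le>K. mscale (z ^ k) (w k)) \<in> W" and "k \<le> K"
  shows "w k \<in> W"
  using assms(2,3)
proof (induction K arbitrary: w k)
  case 0
  interpret vector_space "mscale :: 'a \<Rightarrow> ('n, 'a) mpoly \<Rightarrow> _"
    by (rule vector_space_mscale)
  show ?case
    using "0.prems"(1)[of 1] "0.prems"(2) by simp
next
  case (Suc K)
  interpret vector_space "mscale :: 'a \<Rightarrow> ('n, 'a) mpoly \<Rightarrow> _"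
    by (rule vector_space_mscale)
  define p where "p z = (\<Sum>k\<le>Suc K. mscale (z ^ k) (w k))" for z
  have p: "p z \<in> W" for z
    using Suc.prems(1) by (simp add: p_def)
  have "(\<Sum>k\<le>K. mscale (z ^ k) (mscale (2 ^ k - 2 ^ Suc K) (w k))) \<in> W" for z
  proof -
    have "p (2 * z) - mscale (2 ^ Suc K) (p z)
        = (\<Sum>k\<le>Suc K. mscale (z ^ k) (mscale (2 ^ k - 2 ^ Suc K) (w k)))"
      unfolding p_def scale_sum_right sum_subtractf[symmetric]
      by (intro sum.cong refl)
        (simp only: scale_scale scale_left_diff_distrib[symmetric] power_mult_distrib
          right_diff_distrib mult.commute[of "2 ^ _"])
    then have "p (2 * z) - mscale (2 ^ Suc K) (p z)
        = (\<Sum>k\<le>K. mscale (z ^ k) (mscale (2 ^ k - 2 ^ Suc K) (w k)))"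
      by simp
    then show ?thesis
      using subspace_diff[OF W p subspace_scale[OF W p]] by metis
  qed
  then have low': "mscale (2 ^ k - 2 ^ Suc K) (w k) \<in> W" if "k \<le> K" for k
    using Suc.IH[of "\<lambda>k. mscale (2 ^ k - 2 ^ Suc K) (w k)"] that by blast
  \<comment> \<open>The two powers of 2 differ in characteristic zero, so their difference can be
    divided out.\<close>
  have low: "w k \<in> W" if "k \<le> K" for k
  proof -
    have "(2 ^ k :: nat) \<noteq> 2 ^ Suc K"
      using that by (metis power_inject_exp le_imp_less_Suc less_irrefl one_less_numeral_iff semiring_norm(76))
    then have "(2 ^ k :: 'a) \<noteq> 2 ^ Suc K"
      by (metis of_nat_eq_iff of_nat_numeral of_nat_power)
    then show ?thesis
      using subspace_scale[OF W low'[OF that], of "inverse (2 ^ k - 2 ^ Suc K)"]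
      by (simp del: power_Suc)
  qed
  \<comment> \<open>At \<open>z = 1\<close> all weights are 1, so subtracting the lower coefficients
    isolates the top one.\<close>
  have "w (Suc K) = p 1 - (\<Sum>k\<le>K. w k)"
    by (simp add: p_def)
  also have "\<dots> \<in> W"
    by (intro subspace_diff[OF W] p subspace_sum[OF W] low) auto
  finally show ?case
    using low Suc.prems(2) by (metis le_Suc_eq)
qed

section \<open>Monomials obtained from powers of affine forms\<close>

lemma mconst_1: "mconst 1 = (1 :: ('n, 'a::semiring_1) mpoly)"
  by (simp add: mconst_def)

lemma mconst_add: "mconst (a + b) = (mconst a + mconst b :: ('n, 'a::monoid_add) mpoly)"
  by (simp add: mconst_def single_add)

lemma mconst_mult: "mconst a * mconst b = (mconst (a * b) :: ('n, 'a::semiring_1) mpoly)"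
  by (simp add: mconst_def Poly_Mapping.mult_single)

lemma mconst_power: "mconst a ^ k = (mconst (a ^ k) :: ('n, 'a::comm_semiring_1) mpoly)"
  by (induction k) (simp_all add: mconst_mult mconst_1)

lemma of_nat_mpoly: "of_nat c = (mconst (of_nat c) :: ('n, 'a::semiring_1) mpoly)"
  by (induction c) (auto simp: mconst_def single_add)

text \<open>Variables are split off one at a time: the coefficient of \<open>mvar i\<close> in the
  form becomes a free parameter \<open>z\<close>, and \<open>coeff_in_subspace\<close> extracts the
  coefficient of \<open>z ^ \<alpha> i\<close>.\<close>

lemma monomial_mult_power_mem:
  fixes W :: "('n::finite, 'a::field_char_0) mpoly set"
  assumes W: "module.subspace mscale W" and pow: "\<And>t. affine_form 1 t ^ d \<in> W"
    and "sum \<alpha> S \<le> d"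
  shows "(\<Prod>i\<in>S. mvar i ^ \<alpha> i) * (1 + (\<Sum>i\<in>-S. mconst (t i) * mvar i)) ^ (d - sum \<alpha> S) \<in> W"
  using finite[of S] assms(3)
proof (induction S arbitrary: t rule: finite_induct)
  case empty
  show ?case
    using pow[of t] by (simp add: affine_form_def mconst_1)
next
  case (insert i S)
  interpret vector_space "mscale :: 'a \<Rightarrow> ('n, 'a) mpoly \<Rightarrow> _"
    by (rule vector_space_mscale)
  define K where "K = d - sum \<alpha> S"
  define X where "X = (\<Prod>i\<in>S. (mvar i :: ('n, 'a) mpoly) ^ \<alpha> i)"
  define R where "R = 1 + (\<Sum>j\<in>-insert i S. mconst (t j) * mvar j)"
  \<comment> \<open>By the binomial theorem, \<open>w l\<close> is the coefficient of
    \<open>z ^ l\<close> in \<open>X * (mconst z * mvar i + R) ^ K\<close>.\<close>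
  define w where "w l = of_nat (K choose l) * (mvar i ^ l * R ^ (K - l) * X)" for l
  have le: "\<alpha> i \<le> K" and diff: "d - sum \<alpha> (insert i S) = K - \<alpha> i"
    using insert by (auto simp: K_def)
  have "(\<Sum>l\<le>K. mscale (z ^ l) (w l)) \<in> W" for z
  proof -
    have "-S = insert i (-insert i S)"
      using insert by auto
    then have "1 + (\<Sum>j\<in>-S. mconst ((t(i := z)) j) * mvar j)
        = mconst z * mvar i + (1 + (\<Sum>j\<in>-insert i S. mconst ((t(i := z)) j) * mvar j))"
      by simp
    also have "(\<Sum>j\<in>-insert i S. mconst ((t(i := z)) j) * mvar j)
        = (\<Sum>j\<in>-insert i S. mconst (t j) * mvar j :: ('n, 'a) mpoly)"
      by (rule sum.cong) auto
    finally have *: "1 + (\<Sum>j\<in>-S. mconst ((t(i := z)) j) * mvar j) = mconst z * mvar i + R"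
      by (simp add: R_def)
    have "X * (mconst z * mvar i + R) ^ K \<in> W"
      using insert.IH[of "t(i := z)"] insert.prems insert.hyps unfolding * by (simp add: X_def K_def)
    also have "X * (mconst z * mvar i + R) ^ K = (\<Sum>l\<le>K. mscale (z ^ l) (w l))"
      unfolding binomial_ring sum_distrib_left
      by (rule sum.cong) (simp_all add: w_def mscale_eq_mult power_mult_distrib mconst_power mult_ac)
    finally show ?thesis .
  qed
  then have "w (\<alpha> i) \<in> W"
    using coeff_in_subspace[OF W] le by blast
  \<comment> \<open>The binomial coefficient is invertible because \<open>\<alpha> i \<le> K\<close>
    and the characteristic is zero.\<close>
  then have "mscale (inverse (of_nat (K choose \<alpha> i))) (w (\<alpha> i)) \<in> W"
    by (rule subspace_scale[OF W])
  moreover have "w (\<alpha> i) = mscale (of_nat (K choose \<alpha> i)) (mvar i ^ \<alpha> i * R ^ (K - \<alpha> i) * X)"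
    by (simp add: w_def mscale_eq_mult of_nat_mpoly)
  ultimately have "mvar i ^ \<alpha> i * R ^ (K - \<alpha> i) * X \<in> W"
    using le by simp
  then show ?case
    unfolding diff using insert.hyps by (simp add: X_def R_def mult_ac)
qed

lemma mvar_power: "(mvar i :: ('n, 'a::comm_semiring_1) mpoly) ^ k
    = Poly_Mapping.single (Poly_Mapping.single i k) 1"
  by (induction k) (auto simp: mvar_def Poly_Mapping.mult_single single_add[symmetric])

lemma prod_mvar_power:
  "(\<Prod>i\<in>S. (mvar i :: ('n, 'a::comm_semiring_1) mpoly) ^ \<alpha> i)
    = Poly_Mapping.single (\<Sum>i\<in>S. Poly_Mapping.single i (\<alpha> i)) 1"
  by (induction S rule: infinite_finite_induct) (auto simp: mvar_power Poly_Mapping.mult_single)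

lemma powers_of_affine_forms_span:
  fixes W :: "('n::finite, 'a::field_char_0) mpoly set"
  assumes W: "module.subspace mscale W" and pow: "\<And>t. affine_form 1 t ^ d \<in> W"
    and f: "total_degree f \<le> d"
  shows "f \<in> W"
proof -
  interpret vector_space "mscale :: 'a \<Rightarrow> ('n, 'a) mpoly \<Rightarrow> _"
    by (rule vector_space_mscale)
  have "Poly_Mapping.single e 1 \<in> W" if "e \<in> Poly_Mapping.keys f" for e
  proof -
    have "(\<Sum>i\<in>UNIV. Poly_Mapping.lookup e i) \<le> d"
      using f that by (simp add: total_degree_le_iff)
    \<comment> \<open>With \<open>S = UNIV\<close> the remaining form is the constant 1, so only the
      monomial survives.\<close>
    from monomial_mult_power_mem[OF W pow this]
    have "(\<Prod>i\<in>UNIV. mvar i ^ Poly_Mapping.lookup e i) \<in> W"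
      by simp
    also have "(\<Sum>i\<in>UNIV. Poly_Mapping.single i (Poly_Mapping.lookup e i)) = e"
      by (rule poly_mapping_eqI) (simp add: lookup_sum lookup_single when_def)
    then have "(\<Prod>i\<in>UNIV. mvar i ^ Poly_Mapping.lookup e i)
        = (Poly_Mapping.single e 1 :: ('n, 'a) mpoly)"
      by (simp add: prod_mvar_power)
    finally show ?thesis .
  qed
  then have "(\<Sum>e\<in>Poly_Mapping.keys f. mscale (Poly_Mapping.lookup f e) (Poly_Mapping.single e 1)) \<in> W"
    by (intro subspace_sum[OF W] subspace_scale[OF W])
  moreover have "(\<Sum>e\<in>Poly_Mapping.keys f. mscale (Poly_Mapping.lookup f e) (Poly_Mapping.single e 1)) = f"
    by (rule poly_mapping_eqI)
      (auto simp: lookup_sum lookup_mscale lookup_single when_def in_keys_iff if_distrib cong: if_cong)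
  ultimately show ?thesis
    by simp
qed

section \<open>The rank bound\<close>

lemma matscale_component: "matscale c A $ a $ b = c * A $ a $ b"
  by (simp add: matscale_def)

lemma matscale_mult_left: "matscale c A ** B = matscale c (A ** B)"
  by (vector matscale_component matrix_matrix_mult_def sum_distrib_left mult.assoc)

lemma matscale_mult_right:
  fixes A :: "'a::comm_semiring_1^'n^'m"
  shows "A ** matscale c B = matscale c (A ** B)"
  by (simp add: vec_eq_iff matscale_component matrix_matrix_mult_def sum_distrib_left mult.left_commute)

lemma matrix_polyfun_le_expansion:
  fixes A :: "('n::finite \<Rightarrow> 'a::comm_ring_1) \<Rightarrow> 'a^'k^'m"
  assumes "\<And>a b. polyfun_le k (\<lambda>t. A t $ a $ b)"
  shows "\<exists>C. \<forall>t. A t = (\<Sum>\<alpha>\<in>exponents k. matscale (monomial_value \<alpha> t) (C \<alpha>))"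
proof -
  obtain C where "\<And>a b t. A t $ a $ b = (\<Sum>\<alpha>\<in>exponents k. C a b \<alpha> * monomial_value \<alpha> t)"
    using polyfun_le_expansion[OF assms] by metis
  then show ?thesis
    by (intro exI[of _ "\<lambda>\<alpha>. \<chi> a b. C a b \<alpha>"])
      (simp add: vec_eq_iff sum_component matscale_component mult.commute)
qed

text \<open>
  The factor of lower degree is expanded into monomials; the other one is absorbed into \<open>Y\<close>.
\<close>

lemma matrix_product_expansion:
  fixes U V :: "('n::finite \<Rightarrow> 'a::field) \<Rightarrow> 'a^'m^'m" and G :: "'a^'m^'m"
  assumes U: "\<And>a b. polyfun_le j (\<lambda>t. U t $ a $ b)" and V: "\<And>a b. polyfun_le l (\<lambda>t. V t $ a $ b)"
  shows "\<exists>Z :: ('n \<Rightarrow> nat) \<Rightarrow> 'a^'m^'m \<Rightarrow> 'a^'m^'m.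
    (\<forall>\<alpha>. Vector_Spaces.linear matscale matscale (Z \<alpha>)) \<and> (\<forall>\<alpha> Y. rank (Z \<alpha> Y) \<le> rank G) \<and>
    (\<forall>t. \<exists>Y. U t ** G ** V t = (\<Sum>\<alpha>\<in>exponents (min j l). Z \<alpha> (Y \<alpha>)))"
proof (cases "j \<le> l")
  case True
  obtain C where C: "\<And>t. U t = (\<Sum>\<alpha>\<in>exponents j. matscale (monomial_value \<alpha> t) (C \<alpha>))"
    using matrix_polyfun_le_expansion[OF U] by blast
  have ex: "\<exists>Y. U t ** G ** V t = (\<Sum>\<alpha>\<in>exponents (min j l). C \<alpha> ** G ** Y \<alpha>)" for t
    using True
    by (intro exI[of _ "\<lambda>\<alpha>. matscale (monomial_value \<alpha> t) (V t)"])
      (simp add: C matrix_sum_rdistrib matscale_mult_left matscale_mult_right)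
  have lin: "Vector_Spaces.linear matscale matscale (\<lambda>Y :: 'a^'m^'m. C \<alpha> ** G ** Y)" for \<alpha>
    by (simp add: Vector_Spaces.linear_iff vector_space_matscale matrix_add_ldistrib matscale_mult_right)
  have rk: "rank (C \<alpha> ** G ** Y) \<le> rank G" for \<alpha> and Y :: "'a^'m^'m"
    by (meson order_trans rank_matrix_mult_le_left rank_matrix_mult_le_right)
  show ?thesis
    by (intro exI[of _ "\<lambda>\<alpha> Y :: 'a^'m^'m. C \<alpha> ** G ** Y"] conjI allI lin rk ex)
next
  case False
  obtain C where C: "\<And>t. V t = (\<Sum>\<alpha>\<in>exponents l. matscale (monomial_value \<alpha> t) (C \<alpha>))"
    using matrix_polyfun_le_expansion[OF V] by blast
  have ex: "\<exists>Y. U t ** G ** V t = (\<Sum>\<alpha>\<in>exponents (min j l). Y \<alpha> ** G ** C \<alpha>)" for t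
    using False
    by (intro exI[of _ "\<lambda>\<alpha>. matscale (monomial_value \<alpha> t) (U t)"])
      (simp add: C matrix_sum_ldistrib matscale_mult_left matscale_mult_right)
  have lin: "Vector_Spaces.linear matscale matscale (\<lambda>Y :: 'a^'m^'m. Y ** G ** C \<alpha>)" for \<alpha>
    by (simp add: Vector_Spaces.linear_iff vector_space_matscale matrix_add_rdistrib matscale_mult_left)
  have rk: "rank (Y ** G ** C \<alpha>) \<le> rank G" for \<alpha> and Y :: "'a^'m^'m"
    by (meson order_trans rank_matrix_mult_le_left rank_matrix_mult_le_right)
  show ?thesis
    by (intro exI[of _ "\<lambda>\<alpha> Y :: 'a^'m^'m. Y ** G ** C \<alpha>"] conjI allI lin rk ex)
qed

text \<open>Letting the matrices \<open>Y\<close> vary freely gives the range of a linear map, hence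
  a subspace containing all the sums. Each of its elements has at most \<open>d + 1\<close> groups
  of terms of rank at most \<open>rank G\<close>.\<close>

lemma bounded_rank_subspace:
  fixes U V :: "nat \<Rightarrow> ('n::finite \<Rightarrow> 'a::field) \<Rightarrow> 'a^'m^'m" and G :: "'a^'m^'m"
  assumes U: "\<And>j a b. j \<le> d \<Longrightarrow> polyfun_le j (\<lambda>t. U j t $ a $ b)"
    and V: "\<And>j a b. j \<le> d \<Longrightarrow> polyfun_le (d - j) (\<lambda>t. V j t $ a $ b)"
  shows "\<exists>S. module.subspace matscale S \<and> (\<forall>t. (\<Sum>j\<le>d. U j t ** G ** V j t) \<in> S) \<and>
    (\<forall>X\<in>S. rank X \<le> rank G * (d + 1) * ((CARD('n) + d div 2) choose CARD('n)))"
proof -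
  interpret vector_space "matscale :: 'a \<Rightarrow> 'a^'m^'m \<Rightarrow> _"
    by (rule vector_space_matscale)
  let ?e = "\<lambda>j. exponents (min j (d - j)) :: ('n \<Rightarrow> nat) set"
  have "\<forall>j\<in>{..d}. \<exists>Z :: ('n \<Rightarrow> nat) \<Rightarrow> 'a^'m^'m \<Rightarrow> 'a^'m^'m.
      (\<forall>\<alpha>. Vector_Spaces.linear matscale matscale (Z \<alpha>)) \<and>
      (\<forall>\<alpha> Y. rank (Z \<alpha> Y) \<le> rank G) \<and>
      (\<forall>t. \<exists>Y. U j t ** G ** V j t = (\<Sum>\<alpha>\<in>?e j. Z \<alpha> (Y \<alpha>)))"
    using matrix_product_expansion[OF U V, of _ _ G] by blast
  from bchoice[OF this] obtain Z :: "_ \<Rightarrow> _ \<Rightarrow> 'a^'m^'m \<Rightarrow> 'a^'m^'m"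
    where "\<forall>j\<in>{..d}. (\<forall>\<alpha>. Vector_Spaces.linear matscale matscale (Z j \<alpha>)) \<and>
      (\<forall>\<alpha> Y. rank (Z j \<alpha> Y) \<le> rank G) \<and>
      (\<forall>t. \<exists>Y. U j t ** G ** V j t = (\<Sum>\<alpha>\<in>?e j. Z j \<alpha> (Y \<alpha>)))"
    by (elim exE)
  then have lin: "\<And>j \<alpha>. j \<le> d \<Longrightarrow> Vector_Spaces.linear matscale matscale (Z j \<alpha>)"
    and rk: "\<And>j \<alpha> Y. j \<le> d \<Longrightarrow> rank (Z j \<alpha> Y) \<le> rank G"
    and ex: "\<And>j t. j \<le> d \<Longrightarrow> \<exists>Y. U j t ** G ** V j t = (\<Sum>\<alpha>\<in>?e j. Z j \<alpha> (Y \<alpha>))"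
    by auto
  have add: "Z j \<alpha> (X + Y) = Z j \<alpha> X + Z j \<alpha> Y"
    and scale: "Z j \<alpha> (matscale c X) = matscale c (Z j \<alpha> X)" if "j \<le> d" for j \<alpha> c X Y
    using lin[OF that, of \<alpha>] by (simp_all add: Vector_Spaces.linear_iff)
  define F where "F Y = (\<Sum>j\<le>d. \<Sum>\<alpha>\<in>?e j. Z j \<alpha> (Y j \<alpha>))" for Y
  have F_add: "F X + F Y = F (\<lambda>j \<alpha>. X j \<alpha> + Y j \<alpha>)" for X Y
    by (simp add: F_def add sum.distrib)
  have F_scale: "matscale c (F Y) = F (\<lambda>j \<alpha>. matscale c (Y j \<alpha>))" for c Y
    by (simp add: F_def scale scale_sum_right)
  have "F (\<lambda>_ _. 0) = 0"
    using F_scale[of 0 "\<lambda>_ _. 0"] by simp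
  then have "0 \<in> range F"
    by (metis rangeI)
  then have "subspace (range F)"
    by (auto simp: subspace_def F_add F_scale)
  moreover have "(\<Sum>j\<le>d. U j t ** G ** V j t) \<in> range F" for t
  proof -
    have "\<forall>j\<in>{..d}. \<exists>Y. U j t ** G ** V j t = (\<Sum>\<alpha>\<in>?e j. Z j \<alpha> (Y \<alpha>))"
      using ex by simp
    from bchoice[OF this] obtain Y
      where "\<forall>j\<in>{..d}. U j t ** G ** V j t = (\<Sum>\<alpha>\<in>?e j. Z j \<alpha> (Y j \<alpha>))"
      by (elim exE)
    then have "(\<Sum>j\<le>d. U j t ** G ** V j t) = F Y"
      by (simp add: F_def)
    then show ?thesis
      by blast
  qed
  moreover have "rank (F Y) \<le> rank G * (d + 1) * ((CARD('n) + d div 2) choose CARD('n))" for Y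
  proof -
    let ?b = "(CARD('n) + d div 2) choose CARD('n)"
    have card: "card (?e j) \<le> ?b" for j
    proof -
      have "card (?e j) \<le> (CARD('n) + min j (d - j)) choose CARD('n)"
        using finite_card_exponents by blast
      \<comment> \<open>The smaller of \<open>j\<close> and \<open>d - j\<close> is at most
        \<open>d div 2\<close>.\<close>
      also have "\<dots> \<le> ?b"
        by (rule binomial_right_mono) simp
      finally show ?thesis .
    qed
    have "rank (F Y) \<le> (\<Sum>j\<le>d. \<Sum>\<alpha>\<in>?e j. rank G)"
      unfolding F_def by (intro rank_sum_le rk) simp
    also have "\<dots> \<le> (\<Sum>j\<le>d. ?b * rank G)"
      by (intro sum_mono) (simp add: card)
    also have "\<dots> = rank G * (d + 1) * ?b"
      by (simp add: algebra_simps)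
    finally show ?thesis .
  qed
  ultimately show ?thesis
    by auto
qed

section \<open>Degree bounds for the coefficients of the pencil\<close>

lemma polyfun_le_matrix_mult:
  fixes A B :: "('n \<Rightarrow> 'a::comm_ring_1) \<Rightarrow> 'a^'m^'m"
  assumes "\<And>a b. polyfun_le k (\<lambda>t. A t $ a $ b)" and "\<And>a b. polyfun_le l (\<lambda>t. B t $ a $ b)"
  shows "polyfun_le (k + l) (\<lambda>t. (A t ** B t) $ a $ b)"
  unfolding matrix_matrix_mult_def by (simp add: assms polyfun_le_mult polyfun_le_sum)

text \<open>Each product in the recursion has degree at most \<open>(k - j) + 0 + j = k\<close>, as
  \<open>G\<close> is constant in \<open>t\<close>.\<close>

lemma polyfun_le_solution_coeff:
  fixes N :: "('n \<Rightarrow> 'a::field) \<Rightarrow> nat \<Rightarrow> 'a^'m^'m"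
  assumes N: "\<And>k a b. polyfun_le k (\<lambda>t. N t k $ a $ b)"
  shows "polyfun_le k (\<lambda>t. solution_coeff (N t) G k $ a $ b)"
proof (induction k arbitrary: a b rule: less_induct)
  case (less k)
  have "polyfun_le k (\<lambda>t. (N t (k - j) ** G ** solution_coeff (N t) G j) $ a $ b)" if "j < k" for j
  proof -
    have "polyfun_le (k - j + 0) (\<lambda>t. (N t (k - j) ** G) $ a $ b)" for a b
      by (intro polyfun_le_matrix_mult N polyfun_le.const)
    then have "polyfun_le (k - j + j) (\<lambda>t. (N t (k - j) ** G ** solution_coeff (N t) G j) $ a $ b)"
      by (intro polyfun_le_matrix_mult less.IH that) simp
    then show ?thesis
      using that by simp
  qed
  then show ?case
    by (subst solution_coeff.simps) (auto simp: sum_component intro!: polyfun_le_diff polyfun_le_sum N)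
qed

text \<open>Expanding one affine factor costs one power of some \<open>t i\<close>. \<open>Q\<close>
  is arbitrary so that it can absorb the variable \<open>mvar i\<close> released by this.\<close>

lemma polyfun_le_linear_power:
  fixes L :: "('n::finite, 'a::field) mpoly \<Rightarrow> 'a^'k^'m"
  assumes "Vector_Spaces.linear mscale matscale L"
  shows "polyfun_le k (\<lambda>t. L (Q * affine_form 1 t ^ k) $ a $ b)"
proof -
  interpret Vector_Spaces.linear mscale matscale L by fact
  show ?thesis
  proof (induction k arbitrary: Q)
    case 0
    show ?case
      by (simp add: polyfun_le.const)
  next
    case (Suc k)
    have "L (Q * affine_form 1 t ^ Suc k) $ a $ b = L (Q * affine_form 1 t ^ k) $ a $ b
        + (\<Sum>i\<in>UNIV. t i * L (mvar i * Q * affine_form 1 t ^ k) $ a $ b)" for t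
    proof -
      have "Q * affine_form 1 t ^ Suc k
          = affine_form 1 t * (Q * affine_form 1 t ^ k)"
        by (simp add: mult_ac)
      also have "\<dots> = Q * affine_form 1 t ^ k
          + (\<Sum>i\<in>UNIV. mscale (t i) (mvar i * Q * affine_form 1 t ^ k))"
        by (subst affine_form_def)
          (simp add: mconst_1 mscale_eq_mult distrib_right sum_distrib_right mult.assoc)
      finally show ?thesis
        by (simp add: add sum scale sum_component matscale_component)
    qed
    then show ?case
      using Suc polyfun_le_mono[OF Suc, of "Suc k"] by (auto intro!: polyfun_le.intros polyfun_le_sum)
  qed
qed

theorem mainTheorem1:
  fixes L :: "('n::finite, 'a::{alg_closed_field, field_char_0}) mpoly \<Rightarrow> 'a^'m^'m"
    and d r :: nat
  assumes "d > 0" and "r > 0"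
    and "Vector_Spaces.linear mscale matscale L"
    and "\<And>(a\<^sub>0 :: 'a) (a :: 'n \<Rightarrow> 'a). rank (L (affine_form a\<^sub>0 a ^ d)) \<le> r"
  shows "\<forall>f :: ('n, 'a) mpoly. total_degree f \<le> d \<longrightarrow>
    rank (L f) \<le> r * (d + 1) * ((CARD('n) + d div 2) choose CARD('n))"
proof (intro allI impI)
  fix f :: "('n, 'a) mpoly"
  assume f: "total_degree f \<le> d"
  interpret L: Vector_Spaces.linear mscale matscale L by fact
  \<comment> \<open>A form of maximal rank exists because all these ranks are bounded by
    \<open>r\<close>; the search needs the strict bound \<open>Suc r\<close>.\<close>
  obtain p\<^sub>0 p where max: "\<And>a\<^sub>0 a. rank (L (affine_form a\<^sub>0 a ^ d)) \<le> rank (L (affine_form p\<^sub>0 p ^ d))"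
  proof -
    obtain x where "\<forall>y. rank (L (affine_form (fst y) (snd y) ^ d)) \<le> rank (L (affine_form (fst x) (snd x) ^ d))"
      using ex_has_greatest_nat[of "\<lambda>_. True" _ "\<lambda>y. rank (L (affine_form (fst y) (snd y) ^ d))" "Suc r"]
        assms(4) by (auto simp: less_Suc_eq_le)
    then show ?thesis
      using that[of "fst x" "snd x"] by (metis fst_conv snd_conv)
  qed
  define P where "P = affine_form p\<^sub>0 p"
  \<comment> \<open>\<open>N t k\<close> is the coefficient of \<open>z ^ k\<close> in
    \<open>L ((P + z t) ^ d)\<close>; the binomial coefficient makes it 0 for
    \<open>k > d\<close>.\<close>
  define N where "N t k = matscale (of_nat (d choose k)) (L (P ^ (d - k) * affine_form 1 t ^ k))" for t k
  obtain G where G: "L (P ^ d) ** G ** L (P ^ d) = L (P ^ d)" and "rank G \<le> rank (L (P ^ d))"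
    using generalized_inverse_exists by blast
  then have rank_G: "rank G \<le> r"
    using assms(4)[of p\<^sub>0 p] by (simp add: P_def)
  \<comment> \<open>The constant coefficient does not depend on \<open>t\<close>, so the same
    \<open>G\<close> serves every pencil.\<close>
  have N0: "N t 0 = L (P ^ d)" for t
    by (simp add: N_def)
  have Nd: "N t d = L (affine_form 1 t ^ d)" for t
    by (simp add: N_def)
  have N_rank: "rank (\<chi> a b. \<Sum>k\<le>d. N t k $ a $ b * z ^ k) \<le> rank (N t 0)" for t z
  proof -
    \<comment> \<open>The perturbed form is again affine, so maximality of \<open>P\<close> bounds
      the rank for every \<open>z\<close>.\<close>
    have "affine_form (p\<^sub>0 + z) (\<lambda>i. p i + z * t i) = mconst z * affine_form 1 t + P"
      by (simp add: affine_form_def P_def mconst_add mconst_mult[symmetric] distrib_left distrib_right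
          sum.distrib sum_distrib_left mult.assoc mconst_1)
    then have "affine_form (p\<^sub>0 + z) (\<lambda>i. p i + z * t i) ^ d
        = (\<Sum>k\<le>d. mscale (z ^ k) (mscale (of_nat (d choose k)) (P ^ (d - k) * affine_form 1 t ^ k)))"
      by (simp add: binomial_ring of_nat_mpoly mscale_eq_mult power_mult_distrib mconst_power mult_ac)
    then have "L (affine_form (p\<^sub>0 + z) (\<lambda>i. p i + z * t i) ^ d) = (\<Sum>k\<le>d. matscale (z ^ k) (N t k))"
      by (simp add: L.sum L.scale N_def)
    also have "\<dots> = (\<chi> a b. \<Sum>k\<le>d. N t k $ a $ b * z ^ k)"
      by (simp add: vec_eq_iff sum_component matscale_component mult.commute)
    finally show ?thesis
      using max[of "p\<^sub>0 + z" "\<lambda>i. p i + z * t i"] by (simp add: N0 P_def)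
  qed
  have N_polyfun_le: "polyfun_le k (\<lambda>t. N t k $ a $ b)" for k a b
    by (simp add: N_def matscale_component polyfun_le_cmult polyfun_le_linear_power[OF assms(3)])
  have N_decomp: "N t d = (\<Sum>j\<le>d. N t j ** G ** solution_coeff (N t) G (d - j))" for t
  proof (rule low_rank_decomposition[OF _ _ N_rank])
    show "N t 0 ** G ** N t 0 = N t 0"
      by (simp add: N0 G)
    show "N t k = 0" if "d < k" for k
      using that by (simp add: N_def vec_eq_iff matscale_component)
  qed
  obtain S where S: "module.subspace matscale S" and mem: "\<And>t. N t d \<in> S"
    and bound: "\<And>X. X \<in> S \<Longrightarrow> rank X \<le> rank G * (d + 1) * ((CARD('n) + d div 2) choose CARD('n))"
    using bounded_rank_subspace[of d "\<lambda>j t. N t j" "\<lambda>j t. solution_coeff (N t) G (d - j)" G]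
      N_polyfun_le polyfun_le_solution_coeff[of N, OF N_polyfun_le] unfolding N_decomp[symmetric] by blast
  \<comment> \<open>The preimage of \<open>S\<close> is a subspace containing the powers of all
    forms with constant term 1, hence every polynomial of degree at most \<open>d\<close>.\<close>
  have "f \<in> L -` S"
  proof (rule powers_of_affine_forms_span[OF _ _ f])
    show "L.vs1.subspace (L -` S)"
      using S by (rule L.subspace_vimage)
    show "affine_form 1 t ^ d \<in> L -` S" for t
      using mem[of t] by (simp add: Nd)
  qed
  then have "rank (L f) \<le> rank G * (d + 1) * ((CARD('n) + d div 2) choose CARD('n))"
    by (intro bound) simp
  also have "\<dots> \<le> r * (d + 1) * ((CARD('n) + d div 2) choose CARD('n))"
    using rank_G by (intro mult_right_mono) auto
  finally show "rank (L f) \<le> r * (d + 1) * ((CARD('n) + d div 2) choose CARD('n))" .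
qed

end
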